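(* Let $\Delta=[\boldsymbol p_1,\boldsymbol p_2,\boldsymbol p_3]\subset\mathbb R^2$ be a nondegenerate triangle, let $\boldsymbol R_1,\boldsymbol R_2,\boldsymbol R_3$ be the matrices of polynomials of degree $\le1$ defined in the context, and for $\boldsymbol u\in\mathbb R^2$ let $\boldsymbol U_{d,\boldsymbol u}:=D_{\boldsymbol u}\boldsymbol R_d$ (a constant matrix), $d=1,2,3$. For any point $\boldsymbol x\in\mathbb R^2$ and direction vectors $\boldsymbol u,\boldsymbol v,\boldsymbol w\in\mathbb R^2$, $$D_{\boldsymbol u}\big(\boldsymbol R_1(\boldsymbol x)\boldsymbol R_2(\boldsymbol x)\boldsymbol R_3(\boldsymbol x)\big)=3\,\boldsymbol R_1(\boldsymbol x)\boldsymbol R_2(\boldsymbol x)\boldsymbol U_{3,\boldsymbol u},$$ $$D_{\boldsymbol v}D_{\boldsymbol u}\big(\boldsymbol R_1(\boldsymbol x)\boldsymbol R_2(\boldsymbol x)\boldsymbol R_3(\boldsymbol x)\big)=6\,\boldsymbol R_1(\boldsymbol x)\boldsymbol U_{2,\boldsymbol v}\boldsymbol U_{3,\boldsymbol u},$$ $$D_{\boldsymbol w}D_{\boldsymbol v}D_{\boldsymbol u}\big(\boldsymbol R_1(\boldsymbol x)\boldsymbol R_2(\boldsymbol x)\boldsymbol R_3(\boldsymbol x)\big)=6\,\boldsymbol U_{1,\boldsymbol w}\boldsymbol U_{2,\boldsymbol v}\boldsymbol U_{3,\boldsymbol u},$$ where in the last identity it is assumed that $\boldsymbol x$ is not on a knot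 line of the Powell–Sabin 12-split of $\Delta$.
   Context: $D_{\boldsymbol u}=\boldsymbol u\cdot\nabla$ is applied entrywise. If $(\alpha_1,\alpha_2,\alpha_3)$ are the directional coordinates of $\boldsymbol u$ ($\boldsymbol u=\sum\alpha_i\boldsymbol p_i$, $\sum\alpha_i=0$), then $\boldsymbol U_{d,\boldsymbol u}=\alpha_1\frac{\partial\boldsymbol R_d}{\partial\beta_1}+\alpha_2\frac{\partial\boldsymbol R_d}{\partial\beta_2}+\alpha_3\frac{\partial\boldsymbol R_d}{\partial\beta_3}$. The knot lines of the Powell–Sabin 12-split are the lines through the pairs among the three vertices $\boldsymbol p_1,\boldsymbol p_2,\boldsymbol p_3$ and three edge midpoints of $\Delta$. Let $(\beta_1,\beta_2,\beta_3)$ be the barycentric coordinates of $\boldsymbol x\in\mathbb R^2$ with respect to $\Delta$, $\gamma_j=2\beta_j-1$, $\beta_{i,j}=\beta_i-\beta_j$, $\sigma_{i,j}=\beta_i+\beta_j$. The matrices $\boldsymbol R_d(\boldsymbol x)$ have the following nonzero entries, listed row by row as "column: entry". $\boldsymbol R_1$ ($12\times10$): row 1: $1:\gamma_1,\ 6:2\beta_{3,2},\ 7:4\beta_2$. Row 2: $1:\gamma_1,\ 4:2\beta_{2,3},\ 7:4\beta_3$. Row 3: $2:\gamma_2,\ 4:2\beta_{1,3},\ 8:4\beta_3$. Row 4: $2:\gamma_2,\ 5:2\beta_{3,1},\ 8:4\beta_1$. Row 5: $3:\gamma_3,\ 5:2\beta_{2,1},\ 9:4\beta_1$. Row 6: $3:\gamma_3,\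 6:2\beta_{1,2},\ 9:4\beta_2$. Row 7: $6:2\beta_{3,2},\ 7:4\beta_{1,3},\ 10:-3\gamma_1$. Row 8: $4:2\beta_{2,3},\ 7:4\beta_{1,2},\ 10:-3\gamma_1$. Row 9: $4:2\beta_{1,3},\ 8:4\beta_{2,1},\ 10:-3\gamma_2$. Row 10: $5:2\beta_{3,1},\ 8:4\beta_{2,3},\ 10:-3\gamma_2$. Row 11: $5:2\beta_{2,1},\ 9:4\beta_{3,2},\ 10:-3\gamma_3$. Row 12: $6:2\beta_{1,2},\ 9:4\beta_{3,1},\ 10:-3\gamma_3$. $\boldsymbol R_2$ ($10\times12$): row 1: $1:\gamma_1,\ 2:2\beta_2,\ 12:2\beta_3$. Row 2: $4:2\beta_1,\ 5:\gamma_2,\ 6:2\beta_3$. Row 3: $8:2\beta_2,\ 9:\gamma_3,\ 10:2\beta_1$. Row 4: $2:\beta_{1,3},\ 3:3\beta_3,\ 4:\beta_{2,3}$. Row 5: $6:\beta_{2,1},\ 7:3\beta_1,\ 8:\beta_{3,1}$. Row 6: $10:\beta_{3,2},\ 11:3\beta_2,\ 12:\beta_{1,2}$. Row 7: $2:\frac{\beta_{1,3}}2,\ 3:\frac{3\beta_2}2,\ 11:\frac{3\beta_3}2,\ 12:\frac{\beta_{1,2}}2$. Row 8: $3:\frac{3\beta_1}2,\ 4:\frac{\beta_{2,3}}2,\ 6:\frac{\beta_{2,1}}2,\ 7:\frac{3\beta_3}2$. Row 9: $7:\frac{3\beta_2}2,\ 8:\frac{\beta_{3,1}}2,\ 10:\frac{\beta_{3,2}}2,\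 11:\frac{3\beta_1}2$. Row 10: $3:-\gamma_3,\ 7:-\gamma_1,\ 11:-\gamma_2$. $\boldsymbol R_3$ ($12\times16$): row 1: $1:\gamma_1,\ 2:2\beta_2,\ 12:2\beta_3$. Row 2: $2:\beta_{1,3},\ 3:\beta_2,\ 13:2\beta_3$. Row 3: $3:\frac{\sigma_{1,2}}3,\ 7:\frac{\beta_3}3,\ 11:\frac{\beta_3}3,\ 13:\frac{2\beta_1}3,\ 14:\frac{2\beta_2}3,\ 16:\frac{\beta_3}3$. Row 4: $3:\beta_1,\ 4:\beta_{2,3},\ 14:2\beta_3$. Row 5: $4:2\beta_1,\ 5:\gamma_2,\ 6:2\beta_3$. Row 6: $6:\beta_{2,1},\ 7:\beta_3,\ 14:2\beta_1$. Row 7: $3:\frac{\beta_1}3,\ 7:\frac{\sigma_{2,3}}3,\ 11:\frac{\beta_1}3,\ 14:\frac{2\beta_2}3,\ 15:\frac{2\beta_3}3,\ 16:\frac{\beta_1}3$. Row 8: $7:\beta_2,\ 8:\beta_{3,1},\ 15:2\beta_1$. Row 9: $8:2\beta_2,\ 9:\gamma_3,\ 10:2\beta_1$. Row 10: $10:\beta_{3,2},\ 11:\beta_1,\ 15:2\beta_2$. Row 11: $3:\frac{\beta_2}3,\ 7:\frac{\beta_2}3,\ 11:\frac{\sigma_{1,3}}3,\ 13:\frac{2\beta_1}3,\ 15:\frac{2\beta_3}3,\ 16:\frac{\beta_2}3$. Row 12: $11:\beta_3,\ 12:\beta_{1,2},\ 13:2\beta_2$. *)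

theory Defs
  imports "HOL-Analysis.Analysis"
begin

definition barycentric :: "(3 \<Rightarrow> real^2) \<Rightarrow> real^2 \<Rightarrow> real^3" where
  "barycentric p x = (THE b. (\<Sum>i\<in>UNIV. b $ i) = 1 \<and> (\<Sum>i\<in>UNIV. (b $ i) *\<^sub>R p i) = x)"

text \<open>The matrices are given by their nonzero entries, as a list of rows
  (row index, list of (column index, entry)). In the index type of size \<open>n\<close>, the numeral
  \<open>n\<close> denotes the same element as \<open>0\<close>, so \<open>1, ..., n\<close> enumerates all indices.\<close>

definition sparse_matrix :: "('m \<times> ('n \<times> real) list) list \<Rightarrow> real^'n^'m" where
  "sparse_matrix rs =
    (\<chi> i j. case map_of rs i of
        None \<Rightarrow> 0
      | Some r \<Rightarrow> (case map_of r j of None \<Rightarrow> 0 | Some a \<Rightarrow> a))"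

abbreviation gam :: "real^3 \<Rightarrow> 3 \<Rightarrow> real" where
  "gam b i \<equiv> 2 * b $ i - 1"

abbreviation bdiff :: "real^3 \<Rightarrow> 3 \<Rightarrow> 3 \<Rightarrow> real" where
  "bdiff b i j \<equiv> b $ i - b $ j"

abbreviation sig :: "real^3 \<Rightarrow> 3 \<Rightarrow> 3 \<Rightarrow> real" where
  "sig b i j \<equiv> b $ i + b $ j"

definition R1_bary :: "real^3 \<Rightarrow> real^10^12" where
  "R1_bary b = sparse_matrix [
    (1, [(1, gam b 1), (6, 2 * bdiff b 3 2), (7, 4 * b $ 2)]),
    (2, [(1, gam b 1), (4, 2 * bdiff b 2 3), (7, 4 * b $ 3)]),
    (3, [(2, gam b 2), (4, 2 * bdiff b 1 3), (8, 4 * b $ 3)]),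
    (4, [(2, gam b 2), (5, 2 * bdiff b 3 1), (8, 4 * b $ 1)]),
    (5, [(3, gam b 3), (5, 2 * bdiff b 2 1), (9, 4 * b $ 1)]),
    (6, [(3, gam b 3), (6, 2 * bdiff b 1 2), (9, 4 * b $ 2)]),
    (7, [(6, 2 * bdiff b 3 2), (7, 4 * bdiff b 1 3), (10, - 3 * gam b 1)]),
    (8, [(4, 2 * bdiff b 2 3), (7, 4 * bdiff b 1 2), (10, - 3 * gam b 1)]),
    (9, [(4, 2 * bdiff b 1 3), (8, 4 * bdiff b 2 1), (10, - 3 * gam b 2)]),
    (10, [(5, 2 * bdiff b 3 1), (8, 4 * bdiff b 2 3), (10, - 3 * gam b 2)]),
    (11, [(5, 2 * bdiff b 2 1), (9, 4 * bdiff b 3 2), (10, - 3 * gam b 3)]),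
    (12, [(6, 2 * bdiff b 1 2), (9, 4 * bdiff b 3 1), (10, - 3 * gam b 3)])]"

definition R2_bary :: "real^3 \<Rightarrow> real^12^10" where
  "R2_bary b = sparse_matrix [
    (1, [(1, gam b 1), (2, 2 * b $ 2), (12, 2 * b $ 3)]),
    (2, [(4, 2 * b $ 1), (5, gam b 2), (6, 2 * b $ 3)]),
    (3, [(8, 2 * b $ 2), (9, gam b 3), (10, 2 * b $ 1)]),
    (4, [(2, bdiff b 1 3), (3, 3 * b $ 3), (4, bdiff b 2 3)]),
    (5, [(6, bdiff b 2 1), (7, 3 * b $ 1), (8, bdiff b 3 1)]),
    (6, [(10, bdiff b 3 2), (11, 3 * b $ 2), (12, bdiff b 1 2)]),
    (7, [(2, bdiff b 1 3 / 2), (3, 3 * b $ 2 / 2), (11, 3 * b $ 3 / 2), (12, bdiff b 1 2 / 2)]),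
    (8, [(3, 3 * b $ 1 / 2), (4, bdiff b 2 3 / 2), (6, bdiff b 2 1 / 2), (7, 3 * b $ 3 / 2)]),
    (9, [(7, 3 * b $ 2 / 2), (8, bdiff b 3 1 / 2), (10, bdiff b 3 2 / 2), (11, 3 * b $ 1 / 2)]),
    (10, [(3, - gam b 3), (7, - gam b 1), (11, - gam b 2)])]"

definition R3_bary :: "real^3 \<Rightarrow> real^16^12" where
  "R3_bary b = sparse_matrix [
    (1, [(1, gam b 1), (2, 2 * b $ 2), (12, 2 * b $ 3)]),
    (2, [(2, bdiff b 1 3), (3, b $ 2), (13, 2 * b $ 3)]),
    (3, [(3, sig b 1 2 / 3), (7, b $ 3 / 3), (11, b $ 3 / 3), (13, 2 * b $ 1 / 3), (14, 2 * b $ 2 / 3), (16, b $ 3 / 3)]),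
    (4, [(3, b $ 1), (4, bdiff b 2 3), (14, 2 * b $ 3)]),
    (5, [(4, 2 * b $ 1), (5, gam b 2), (6, 2 * b $ 3)]),
    (6, [(6, bdiff b 2 1), (7, b $ 3), (14, 2 * b $ 1)]),
    (7, [(3, b $ 1 / 3), (7, sig b 2 3 / 3), (11, b $ 1 / 3), (14, 2 * b $ 2 / 3), (15, 2 * b $ 3 / 3), (16, b $ 1 / 3)]),
    (8, [(7, b $ 2), (8, bdiff b 3 1), (15, 2 * b $ 1)]),
    (9, [(8, 2 * b $ 2), (9, gam b 3), (10, 2 * b $ 1)]),
    (10, [(10, bdiff b 3 2), (11, b $ 1), (15, 2 * b $ 2)]),
    (11, [(3, b $ 2 / 3), (7, b $ 2 / 3), (11, sig b 1 3 / 3), (13, 2 * b $ 1 / 3), (15, 2 * b $ 3 / 3), (16, b $ 2 / 3)]),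
    (12, [(11, b $ 3), (12, bdiff b 1 2), (13, 2 * b $ 2)])]"

definition R1 :: "(3 \<Rightarrow> real^2) \<Rightarrow> real^2 \<Rightarrow> real^10^12" where
  "R1 p x = R1_bary (barycentric p x)"

definition R2 :: "(3 \<Rightarrow> real^2) \<Rightarrow> real^2 \<Rightarrow> real^12^10" where
  "R2 p x = R2_bary (barycentric p x)"

definition R3 :: "(3 \<Rightarrow> real^2) \<Rightarrow> real^2 \<Rightarrow> real^16^12" where
  "R3 p x = R3_bary (barycentric p x)"

definition grad :: "(real^2 \<Rightarrow> real) \<Rightarrow> real^2 \<Rightarrow> real^2" where
  "grad f x = (THE g. GDERIV f x :> g)"

text \<open>The operator \<open>u \<bullet> \<nabla>\<close>, applied entrywise to a matrix-valued function.\<close>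

definition dir_deriv :: "real^2 \<Rightarrow> (real^2 \<Rightarrow> real^'n^'m) \<Rightarrow> real^2 \<Rightarrow> real^'n^'m" where
  "dir_deriv u F x = (\<chi> i j. u \<bullet> grad (\<lambda>y. F y $ i $ j) x)"

text \<open>For an affine matrix-valued function \<open>F\<close>, the function \<open>dir_deriv u F\<close> is constant;
  the following picks out its value.\<close>

definition const_dir_deriv :: "real^2 \<Rightarrow> (real^2 \<Rightarrow> real^'n^'m) \<Rightarrow> real^'n^'m" where
  "const_dir_deriv u F = (THE M. \<forall>y. dir_deriv u F y = M)"

definition U1 :: "(3 \<Rightarrow> real^2) \<Rightarrow> real^2 \<Rightarrow> real^10^12" where
  "U1 p u = const_dir_deriv u (R1 p)"

definition U2 :: "(3 \<Rightarrow> real^2) \<Rightarrow> real^2 \<Rightarrow> real^12^10" where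
  "U2 p u = const_dir_deriv u (R2 p)"

definition U3 :: "(3 \<Rightarrow> real^2) \<Rightarrow> real^2 \<Rightarrow> real^16^12" where
  "U3 p u = const_dir_deriv u (R3 p)"

definition ps12_points :: "(3 \<Rightarrow> real^2) \<Rightarrow> (real^2) set" where
  "ps12_points p = {p 1, p 2, p 3, midpoint (p 1) (p 2), midpoint (p 2) (p 3), midpoint (p 3) (p 1)}"

definition knot_lines :: "(3 \<Rightarrow> real^2) \<Rightarrow> (real^2) set set" where
  "knot_lines p = {affine hull {a, b} | a b. a \<in> ps12_points p \<and> b \<in> ps12_points p \<and> a \<noteq> b}"

end

theory Submission
  imports Defs
begin

text \<open>The matrices are affine in \<open>x\<close> and satisfy the exchange relations
  \<open>R\<^sub>d(x) R\<^bsub>d+1\<^esub>(y) = R\<^sub>d(y) R\<^bsub>d+1\<^esub>(x)\<close> for all points \<open>x, y\<close>, a finite list of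
  polynomial identities in barycentric coordinates. Since \<open>U\<^bsub>d,u\<^esub> = R\<^sub>d(u) - R\<^sub>d(0)\<close>, subtracting two
  instances gives \<open>U\<^bsub>d,u\<^esub> R\<^bsub>d+1\<^esub>(x) = R\<^sub>d(x) U\<^bsub>d+1,u\<^esub>\<close>, so all summands produced by the
  product rule agree.\<close>

section \<open>Numeral index types and entries of sparse matrices\<close>

lemma exhaust_10:
  fixes x :: 10
  shows "x = 1 \<or> x = 2 \<or> x = 3 \<or> x = 4 \<or> x = 5 \<or> x = 6 \<or> x = 7 \<or> x = 8 \<or> x = 9 \<or> x = 10"
proof (induct x)
  case (of_int z)
  \<comment> \<open>Integer representatives start at 0; the case \<open>z = 0\<close> becomes the
    disjunct \<open>x = 10\<close>, since both numerals denote the same element.\<close>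
  then have "z = 0 \<or> z = 1 \<or> z = 2 \<or> z = 3 \<or> z = 4 \<or> z = 5 \<or> z = 6 \<or> z = 7 \<or> z = 8 \<or> z = 9"
    by (simp; arith)
  then show ?case by auto
qed

lemma exhaust_12:
  fixes x :: 12
  shows "x = 1 \<or> x = 2 \<or> x = 3 \<or> x = 4 \<or> x = 5 \<or> x = 6 \<or> x = 7 \<or> x = 8 \<or> x = 9 \<or> x = 10
    \<or> x = 11 \<or> x = 12"
proof (induct x)
  case (of_int z)
  then have "z = 0 \<or> z = 1 \<or> z = 2 \<or> z = 3 \<or> z = 4 \<or> z = 5 \<or> z = 6 \<or> z = 7 \<or> z = 8 \<or> z = 9
    \<or> z = 10 \<or> z = 11"
    by (simp; arith)
  then show ?case by auto
qed

lemma forall_10: "(\<forall>i::10. P i) \<longleftrightarrow>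
    P 1 \<and> P 2 \<and> P 3 \<and> P 4 \<and> P 5 \<and> P 6 \<and> P 7 \<and> P 8 \<and> P 9 \<and> P 10"
  (is "_ \<longleftrightarrow> ?rhs")
proof (intro iffI allI)
  fix i :: 10 assume "?rhs"
  then show "P i" using exhaust_10[of i] by (elim disjE) simp_all
qed simp

lemma forall_12: "(\<forall>i::12. P i) \<longleftrightarrow>
    P 1 \<and> P 2 \<and> P 3 \<and> P 4 \<and> P 5 \<and> P 6 \<and> P 7 \<and> P 8 \<and> P 9 \<and> P 10 \<and> P 11 \<and> P 12"
  (is "_ \<longleftrightarrow> ?rhs")
proof (intro iffI allI)
  fix i :: 12 assume "?rhs"
  then show "P i" using exhaust_12[of i] by (elim disjE) simp_all
qed simp

text \<open>With distinct columns, \<open>map_of\<close> overlooks no list entry, so removing the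
  head of the list removes exactly one summand from the dense sum.\<close>

lemma sparse_row_sum:
  fixes r :: "('n::finite \<times> real) list"
  assumes "distinct (map fst r)"
  shows "(\<Sum>k\<in>UNIV. (case map_of r k of None \<Rightarrow> 0 | Some a \<Rightarrow> a) * f k)
    = (\<Sum>(k, a)\<leftarrow>r. a * f k)"
  using assms
proof (induction r)
  case (Cons ka r)
  obtain k a where ka: "ka = (k, a)" by force
  with Cons.prems have "map_of r k = None"
    by (simp add: map_of_eq_None_iff)
  then have "(case map_of (ka # r) l of None \<Rightarrow> 0 | Some c \<Rightarrow> c) * f l
      = (if l = k then a * f k else 0) + (case map_of r l of None \<Rightarrow> 0 | Some c \<Rightarrow> c) * f l" for l
    by (simp add: ka)
  then show ?case
    using Cons by (simp add: ka sum.distrib)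
qed simp

lemma sparse_matrix_mult_nth:
  assumes "map_of rs i = Some r" "distinct (map fst r)"
  shows "(sparse_matrix rs ** B) $ i $ j = (\<Sum>(k, a)\<leftarrow>r. a * B $ k $ j)"
  using assms sparse_row_sum[of r "\<lambda>k. B $ k $ j"]
  by (simp add: matrix_matrix_mult_def sparse_matrix_def)

text \<open>This is the product formula with \<open>B = mat 1\<close>. The column \<open>j\<close>
  stays symbolic inside \<open>of_bool\<close>, so later entrywise identities need a case split over
  the rows only.\<close>

lemma sparse_matrix_nth:
  assumes "map_of rs i = Some r" "distinct (map fst r)"
  shows "sparse_matrix rs $ i $ j = (\<Sum>(k, a)\<leftarrow>r. a * of_bool (k = j))"
  using sparse_matrix_mult_nth[OF assms, of "mat 1" j]
  by (simp add: matrix_mul_rid) (simp add: mat_def of_bool_def)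

section \<open>Affine dependence on the barycentric coordinates\<close>

text \<open>Every entry has degree at most one in the coordinates, and constant terms come from
  \<open>gam\<close> alone; subtracting the value at the zero vector cancels them.\<close>

lemma R1_bary_linear_part: "linear (\<lambda>b. R1_bary b - R1_bary 0)"
proof -
  have "\<forall>i. (R1_bary (b + c) - R1_bary 0) $ i $ j =
      (R1_bary b - R1_bary 0 + (R1_bary c - R1_bary 0)) $ i $ j" for b c j
    unfolding forall_12
    by (intro conjI; simp add: R1_bary_def sparse_matrix_nth; simp add: field_simps)
  moreover have "\<forall>i. (R1_bary (t *\<^sub>R b) - R1_bary 0) $ i $ j =
      (t *\<^sub>R (R1_bary b - R1_bary 0)) $ i $ j" for t b j
    unfolding forall_12
    by (intro conjI; simp add: R1_bary_def sparse_matrix_nth; simp add: field_simps)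
  ultimately show ?thesis
    by (intro linearI) (simp_all add: vec_eq_iff)
qed

lemma R2_bary_linear_part: "linear (\<lambda>b. R2_bary b - R2_bary 0)"
proof -
  have "\<forall>i. (R2_bary (b + c) - R2_bary 0) $ i $ j =
      (R2_bary b - R2_bary 0 + (R2_bary c - R2_bary 0)) $ i $ j" for b c j
    unfolding forall_10
    by (intro conjI; simp add: R2_bary_def sparse_matrix_nth; simp add: field_simps)
  moreover have "\<forall>i. (R2_bary (t *\<^sub>R b) - R2_bary 0) $ i $ j =
      (t *\<^sub>R (R2_bary b - R2_bary 0)) $ i $ j" for t b j
    unfolding forall_10
    by (intro conjI; simp add: R2_bary_def sparse_matrix_nth; simp add: field_simps)
  ultimately show ?thesis
    by (intro linearI) (simp_all add: vec_eq_iff)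
qed

lemma R3_bary_linear_part: "linear (\<lambda>b. R3_bary b - R3_bary 0)"
proof -
  have "\<forall>i. (R3_bary (b + c) - R3_bary 0) $ i $ j =
      (R3_bary b - R3_bary 0 + (R3_bary c - R3_bary 0)) $ i $ j" for b c j
    unfolding forall_12
    by (intro conjI; simp add: R3_bary_def sparse_matrix_nth; simp add: field_simps)
  moreover have "\<forall>i. (R3_bary (t *\<^sub>R b) - R3_bary 0) $ i $ j =
      (t *\<^sub>R (R3_bary b - R3_bary 0)) $ i $ j" for t b j
    unfolding forall_12
    by (intro conjI; simp add: R3_bary_def sparse_matrix_nth; simp add: field_simps)
  ultimately show ?thesis
    by (intro linearI) (simp_all add: vec_eq_iff)
qed

section \<open>Exchange relations\<close>

lemma R1_R2_bary_exchange:
  assumes "(\<Sum>i\<in>UNIV. b $ i) = 1" "(\<Sum>i\<in>UNIV. c $ i) = 1"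
  shows "R1_bary b ** R2_bary c = R1_bary c ** R2_bary b"
proof -
  \<comment> \<open>The constraint that the coordinates sum to one enters here: eliminating the
    third coordinates leaves polynomials in four free variables, compared entry by entry.\<close>
  have b: "b $ 3 = 1 - b $ 1 - b $ 2" and c: "c $ 3 = 1 - c $ 1 - c $ 2"
    using assms by (simp_all add: sum_3)
  have "\<forall>i. (R1_bary b ** R2_bary c) $ i $ j = (R1_bary c ** R2_bary b) $ i $ j" for j
    unfolding forall_12
    by (intro conjI; simp add: R1_bary_def sparse_matrix_mult_nth;
        simp add: R2_bary_def sparse_matrix_nth; simp add: b c field_simps)
  then show ?thesis by (simp add: vec_eq_iff)
qed

lemma R2_R3_bary_exchange:
  assumes "(\<Sum>i\<in>UNIV. b $ i) = 1" "(\<Sum>i\<in>UNIV. c $ i) = 1"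
  shows "R2_bary b ** R3_bary c = R2_bary c ** R3_bary b"
proof -
  have b: "b $ 3 = 1 - b $ 1 - b $ 2" and c: "c $ 3 = 1 - c $ 1 - c $ 2"
    using assms by (simp_all add: sum_3)
  have "\<forall>i. (R2_bary b ** R3_bary c) $ i $ j = (R2_bary c ** R3_bary b) $ i $ j" for j
    unfolding forall_10
    by (intro conjI; simp add: R2_bary_def sparse_matrix_mult_nth;
        simp add: R3_bary_def sparse_matrix_nth; simp add: b c field_simps)
  then show ?thesis by (simp add: vec_eq_iff)
qed

section \<open>Directional derivatives of matrix-valued functions\<close>

lemma bounded_bilinear_matrix_mult:
  "bounded_bilinear ((**) :: real^'n^'m \<Rightarrow> real^'k^'n \<Rightarrow> real^'k^'m)"
  unfolding bilinear_conv_bounded_bilinear[symmetric] bilinear_def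
  by (intro conjI allI linearI; simp add: vec_eq_iff matrix_matrix_mult_def
      distrib_left distrib_right sum.distrib sum_distrib_left mult.left_commute mult.assoc)

lemma dir_deriv_eqI:
  assumes "(F has_derivative F') (at x)"
  shows "dir_deriv u F x = F' u"
proof -
  have "u \<bullet> grad (\<lambda>y. F y $ i $ j) x = F' u $ i $ j" for i j
  proof -
    have d: "((\<lambda>y. F y $ i $ j) has_derivative (\<lambda>h. F' h $ i $ j)) (at x)"
      by (intro bounded_linear.has_derivative[OF bounded_linear_vec_nth] assms)
    \<comment> \<open>The gradient is the vector representing the derivative functional: the adjoint
      of a map into the reals, evaluated at 1.\<close>
    define g where "g = adjoint (\<lambda>h. F' h $ i $ j) 1"
    have g: "F' h $ i $ j = h \<bullet> g" for h
      using adjoint_works[OF has_derivative_linear[OF d], of h 1] by (simp add: g_def)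
    have "grad (\<lambda>y. F y $ i $ j) x = g"
      unfolding grad_def
    proof (rule the_equality)
      show "GDERIV (\<lambda>y. F y $ i $ j) x :> g"
        using d by (simp add: gderiv_def g)
    next
      fix g' assume "GDERIV (\<lambda>y. F y $ i $ j) x :> g'"
      then have "(\<lambda>h. h \<bullet> g') = (\<lambda>h. h \<bullet> g)"
        using d has_derivative_unique by (auto simp: gderiv_def g)
      then show "g' = g"
        by (metis inner_commute vector_eq_ldot)
    qed
    then show ?thesis by (simp add: g)
  qed
  then show ?thesis by (simp add: dir_deriv_def vec_eq_iff)
qed

lemma affine_has_derivative:
  fixes F :: "real^2 \<Rightarrow> real^'n^'m"
  assumes "linear (\<lambda>y. F y - F 0)"
  shows "(F has_derivative (\<lambda>h. F h - F 0)) (at x)"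
  using has_derivative_add[OF linear_imp_has_derivative[OF assms] has_derivative_const[of "F 0"]]
  by simp

lemma const_dir_deriv_affine:
  fixes F :: "real^2 \<Rightarrow> real^'n^'m"
  assumes "linear (\<lambda>y. F y - F 0)"
  shows "const_dir_deriv u F = F u - F 0"
  unfolding const_dir_deriv_def dir_deriv_eqI[OF affine_has_derivative[OF assms]] by auto

section \<open>Barycentric coordinates as an affine map\<close>

text \<open>Homogenization: the map \<open>T\<close> from coordinates to their sum and weighted
  point is linear and, by noncollinearity, invertible. Its inverse \<open>g\<close> on the slice
  with first component 1 gives the barycentric coordinates.\<close>

lemma barycentric_affine:
  assumes "\<not> collinear {p 1, p 2, p 3}"
  obtains g :: "real \<times> (real^2) \<Rightarrow> real^3" where "linear g" "\<And>x. barycentric p x = g (1, x)"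
    "\<And>x. (\<Sum>i\<in>UNIV. barycentric p x $ i) = 1"
proof -
  define T where "T b = ((\<Sum>i\<in>UNIV. b $ i), (\<Sum>i\<in>UNIV. (b $ i) *\<^sub>R p i))" for b :: "real^3"
  have lin: "linear T"
    by (rule linearI; simp add: T_def sum.distrib scaleR_add_left sum_distrib_left scaleR_sum_right)
  have "b = 0" if "T b = 0" for b
  proof -
    have s: "b $ 1 + b $ 2 + b $ 3 = 0"
      and t: "b $ 1 *\<^sub>R p 1 + b $ 2 *\<^sub>R p 2 + b $ 3 *\<^sub>R p 3 = 0"
      using that by (simp_all add: T_def sum_3 zero_prod_def)
    have "\<not> collinear {0, p 2 - p 1, p 3 - p 1}"
      using assms collinear_3[of "p 2" "p 1" "p 3"] by (simp add: insert_commute)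
    then have nc: "p 2 - p 1 \<noteq> 0" "\<And>c. p 3 - p 1 \<noteq> c *\<^sub>R (p 2 - p 1)"
      by (auto simp: collinear_lemma)
    have b1: "b $ 1 = - (b $ 2) - b $ 3"
      using s by simp
    \<comment> \<open>Eliminating \<open>b $ 1\<close> leaves a relation between the two edge
      vectors at \<open>p 1\<close>, which are linearly independent by \<open>nc\<close>.\<close>
    have *: "b $ 2 *\<^sub>R (p 2 - p 1) + b $ 3 *\<^sub>R (p 3 - p 1) = 0"
      using t unfolding b1 by (simp add: algebra_simps)
    have b3: "b $ 3 = 0"
    proof (rule ccontr)
      assume "b $ 3 \<noteq> 0"
      then have "b $ 3 *\<^sub>R (p 3 - p 1) = b $ 3 *\<^sub>R ((- (b $ 2) / b $ 3) *\<^sub>R (p 2 - p 1))"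
        using * by (simp add: add_eq_0_iff)
      with \<open>b $ 3 \<noteq> 0\<close> have "p 3 - p 1 = (- (b $ 2) / b $ 3) *\<^sub>R (p 2 - p 1)"
        by (metis scaleR_cancel_left)
      then show False using nc(2) by blast
    qed
    with * nc(1) have "b $ 2 = 0" by simp
    with b1 b3 show ?thesis by (simp add: vec_eq_iff forall_3)
  qed
  then have "inj T"
    using lin linear_injective_0 by blast
  \<comment> \<open>Source and target both have dimension three, so the injective map
    \<open>T\<close> has a two-sided inverse.\<close>
  then obtain g where g: "linear g" "\<And>b. g (T b) = b" "\<And>y. T (g y) = y"
    using eucl.linear_injective_isomorphism[OF lin] by (auto simp: dim_UNIV)
  have eq: "barycentric p x = g (1, x)" for x
    unfolding barycentric_def
  proof (rule the_equality)
    show "(\<Sum>i\<in>UNIV. g (1, x) $ i) = 1 \<and> (\<Sum>i\<in>UNIV. g (1, x) $ i *\<^sub>R p i) = x"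
      using g(3)[of "(1, x)"] by (simp add: T_def)
  next
    fix b :: "real^3"
    assume "(\<Sum>i\<in>UNIV. b $ i) = 1 \<and> (\<Sum>i\<in>UNIV. b $ i *\<^sub>R p i) = x"
    then show "b = g (1, x)"
      using g(2)[of b] by (simp add: T_def)
  qed
  moreover have "(\<Sum>i\<in>UNIV. barycentric p x $ i) = 1" for x
    using g(3)[of "(1, x)"] by (simp add: T_def eq)
  ultimately show ?thesis
    using that[of g] g(1) by blast
qed

lemma affine_compose_barycentric:
  assumes "linear g" "linear (\<lambda>b. R b - R 0)" "\<And>x. \<beta> x = g (1::real, x)"
  shows "linear (\<lambda>x. R (\<beta> x) - R (\<beta> 0))"
proof -
  \<comment> \<open>The homogenizing component cancels:
    \<open>g (1, x) - g (1, 0) = g (0, x)\<close>. The linear part of \<open>R\<close> carries this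
    difference over.\<close>
  have "R (\<beta> x) - R (\<beta> 0) = R (g (0, x)) - R 0" for x
    using linear_diff[OF assms(2), of "g (1, x)" "g (1, 0)"] linear_diff[OF assms(1), of "(1, x)" "(1, 0)"]
    by (simp add: assms(3))
  moreover have "linear (\<lambda>x. R (g (0, x)) - R 0)"
    using linear_compose[OF linear_compose[OF _ assms(1)] assms(2), of "\<lambda>x. (0, x)"]
    by (simp add: o_def linear_iff)
  ultimately show ?thesis by simp
qed

section \<open>Differentiating products of exchanging affine families\<close>

text \<open>The successive derivatives have three, two and one equal summands, whence the factors 3,
  2 and 1. Equalities of functions and a free scalar \<open>c\<close> let each result be rewritten
  under the next derivative.\<close>

lemma dir_deriv_exchanging_product:
  fixes F1 :: "real^2 \<Rightarrow> real^'b^'a" and F2 :: "real^2 \<Rightarrow> real^'c^'b"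
    and F3 :: "real^2 \<Rightarrow> real^'d^'c"
  assumes lin: "linear (\<lambda>y. F1 y - F1 0)" "linear (\<lambda>y. F2 y - F2 0)" "linear (\<lambda>y. F3 y - F3 0)"
    and ex12: "\<And>x y. F1 x ** F2 y = F1 y ** F2 x"
    and ex23: "\<And>x y. F2 x ** F3 y = F2 y ** F3 x"
  defines "V1 \<equiv> \<lambda>u. F1 u - F1 0" and "V2 \<equiv> \<lambda>u. F2 u - F2 0" and "V3 \<equiv> \<lambda>u. F3 u - F3 0"
  shows "dir_deriv u (\<lambda>y. F1 y ** F2 y ** F3 y) = (\<lambda>x. 3 *\<^sub>R (F1 x ** F2 x ** V3 u))"
    and "dir_deriv v (\<lambda>x. c *\<^sub>R (F1 x ** F2 x ** V3 u)) = (\<lambda>x. (2 * c) *\<^sub>R (F1 x ** V2 v ** V3 u))"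
    and "dir_deriv w (\<lambda>x. c *\<^sub>R (F1 x ** V2 v ** V3 u)) = (\<lambda>x. c *\<^sub>R (V1 w ** V2 v ** V3 u))"
proof -
  note mult_diff = bounded_bilinear.diff_left[OF bounded_bilinear_matrix_mult]
    bounded_bilinear.diff_right[OF bounded_bilinear_matrix_mult]
  note mult_add = bounded_bilinear.add_left[OF bounded_bilinear_matrix_mult]
  note FD = bounded_bilinear.FDERIV[OF bounded_bilinear_matrix_mult]
  have d1: "(F1 has_derivative V1) (at x)" and d2: "(F2 has_derivative V2) (at x)"
    and d3: "(F3 has_derivative V3) (at x)" for x
    unfolding V1_def V2_def V3_def by (simp_all add: affine_has_derivative lin)
  have sw12: "V1 h ** F2 x = F1 x ** V2 h" for h x
    by (simp add: V1_def V2_def mult_diff ex12[of _ x])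
  have sw23: "V2 h ** F3 x = F2 x ** V3 h" for h x
    by (simp add: V2_def V3_def mult_diff ex23[of _ x])
  show "dir_deriv u (\<lambda>y. F1 y ** F2 y ** F3 y) = (\<lambda>x. 3 *\<^sub>R (F1 x ** F2 x ** V3 u))"
  proof
    fix x
    have "dir_deriv u (\<lambda>y. F1 y ** F2 y ** F3 y) x
        = F1 x ** F2 x ** V3 u + (F1 x ** V2 u + V1 u ** F2 x) ** F3 x"
      by (rule dir_deriv_eqI[OF FD[OF FD[OF d1 d2] d3]])
    \<comment> \<open>\<open>sw12\<close> moves the increment from the first factor to the second,
      giving two equal terms; \<open>sw23\<close> then moves it to the third.\<close>
    also have "\<dots> = F1 x ** F2 x ** V3 u + (F1 x ** (V2 u ** F3 x) + F1 x ** (V2 u ** F3 x))"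
      by (simp only: sw12 mult_add matrix_mul_assoc)
    also have "\<dots> = 3 *\<^sub>R (F1 x ** F2 x ** V3 u)"
      using scaleR_left_distrib[of 1 2 "F1 x ** F2 x ** V3 u"]
      by (simp add: sw23 matrix_mul_assoc scaleR_2)
    finally show "dir_deriv u (\<lambda>y. F1 y ** F2 y ** F3 y) x = 3 *\<^sub>R (F1 x ** F2 x ** V3 u)" .
  qed
  note scaled = has_derivative_scaleR_right[of _ _ _ c]
  note mult_zero = bounded_bilinear.zero_right[OF bounded_bilinear_matrix_mult]
  show "dir_deriv v (\<lambda>x. c *\<^sub>R (F1 x ** F2 x ** V3 u)) = (\<lambda>x. (2 * c) *\<^sub>R (F1 x ** V2 v ** V3 u))"
  proof
    fix x
    have "dir_deriv v (\<lambda>x. c *\<^sub>R (F1 x ** F2 x ** V3 u)) x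
        = c *\<^sub>R (F1 x ** F2 x ** 0 + (F1 x ** V2 v + V1 v ** F2 x) ** V3 u)"
      by (rule dir_deriv_eqI[OF scaled[OF FD[OF FD[OF d1 d2] has_derivative_const]]])
    also have "\<dots> = c *\<^sub>R (F1 x ** V2 v ** V3 u + F1 x ** V2 v ** V3 u)"
      by (simp only: sw12 mult_add mult_zero add_0)
    finally show "dir_deriv v (\<lambda>x. c *\<^sub>R (F1 x ** F2 x ** V3 u)) x = (2 * c) *\<^sub>R (F1 x ** V2 v ** V3 u)"
      by (simp only: scaleR_2[symmetric] scaleR_scaleR mult.commute[of c])
  qed
  show "dir_deriv w (\<lambda>x. c *\<^sub>R (F1 x ** V2 v ** V3 u)) = (\<lambda>x. c *\<^sub>R (V1 w ** V2 v ** V3 u))"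
  proof
    fix x
    have "dir_deriv w (\<lambda>x. c *\<^sub>R (F1 x ** V2 v ** V3 u)) x
        = c *\<^sub>R (F1 x ** V2 v ** 0 + (F1 x ** 0 + V1 w ** V2 v) ** V3 u)"
      by (rule dir_deriv_eqI[OF scaled[OF FD[OF FD[OF d1 has_derivative_const] has_derivative_const]]])
    then show "dir_deriv w (\<lambda>x. c *\<^sub>R (F1 x ** V2 v ** V3 u)) x = c *\<^sub>R (V1 w ** V2 v ** V3 u)"
      by (simp only: mult_zero add_0)
  qed
qed

theorem theorem3p11:
  fixes p :: "3 \<Rightarrow> real^2" and x u v w :: "real^2"
  assumes "\<not> collinear {p 1, p 2, p 3}"
  shows "dir_deriv u (\<lambda>y. R1 p y ** R2 p y ** R3 p y) x
           = 3 *\<^sub>R (R1 p x ** R2 p x ** U3 p u)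
    \<and> dir_deriv v (dir_deriv u (\<lambda>y. R1 p y ** R2 p y ** R3 p y)) x
           = 6 *\<^sub>R (R1 p x ** U2 p v ** U3 p u)
    \<and> (x \<notin> \<Union> (knot_lines p) \<longrightarrow>
        dir_deriv w (dir_deriv v (dir_deriv u (\<lambda>y. R1 p y ** R2 p y ** R3 p y))) x
           = 6 *\<^sub>R (U1 p w ** U2 p v ** U3 p u))"
proof -
  obtain g :: "real \<times> (real^2) \<Rightarrow> real^3"
    where g: "linear g" "\<And>x. barycentric p x = g (1, x)"
    and sum1: "\<And>x. (\<Sum>i\<in>UNIV. barycentric p x $ i) = 1"
    using barycentric_affine[OF assms] by blast
  note affine = affine_compose_barycentric[OF g(1) _ g(2)]
  have lin: "linear (\<lambda>y. R1 p y - R1 p 0)" "linear (\<lambda>y. R2 p y - R2 p 0)"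
      "linear (\<lambda>y. R3 p y - R3 p 0)"
    unfolding R1_def R2_def R3_def
    by (rule affine[of R1_bary, OF R1_bary_linear_part] affine[of R2_bary, OF R2_bary_linear_part]
        affine[of R3_bary, OF R3_bary_linear_part])+
  have ex: "R1 p y ** R2 p z = R1 p z ** R2 p y" "R2 p y ** R3 p z = R2 p z ** R3 p y" for y z
    unfolding R1_def R2_def R3_def
    by (intro R1_R2_bary_exchange R2_R3_bary_exchange sum1)+
  have U: "U1 p h = R1 p h - R1 p 0" "U2 p h = R2 p h - R2 p 0" "U3 p h = R3 p h - R3 p 0" for h
    unfolding U1_def U2_def U3_def by (simp_all only: const_dir_deriv_affine[OF lin(1)]
        const_dir_deriv_affine[OF lin(2)] const_dir_deriv_affine[OF lin(3)])
  \<comment> \<open>Folding \<open>U\<close> identifies the increments with the constant derivative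
    matrices. The nested derivatives are then rewritten from the inside out, with
    \<open>c = 3\<close> and then \<open>c = 6\<close>.\<close>
  note D = dir_deriv_exchanging_product[OF lin ex, folded U]
  show ?thesis
    by (simp add: D)
qed

end
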